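(* Let $G$ be a connected graph of order $n\geq 4$ and size $m$ with clique number $\omega\geq 2$. Let $H=G\setminus K_{\omega}$ be the graph obtained from $G$ by deleting the edges of a clique $K_\omega$ of $G$ (keeping all vertices), and suppose that $H$ has $r$ non-trivial components $C_1,\dots,C_r$, each of which is a $c$-cyclic graph, and $p\geq 0$ trivial components. Then for every integer $k$ with $1\le k\le n$, \[ S_k(G)\leq\begin{cases}\omega(\omega-1)+n-p+2r(c-1)+2k, & \text{if } k\geq \omega -1,\\ k(\omega+2)+n-p+2r(c-1), & \text{if } k\leq \omega-2.\end{cases} \]
   Context: For a graph $G$ with adjacency matrix $A(G)$ and diagonal degree matrix $D(G)$, the Laplacian matrix is $L(G)=D(G)-A(G)$, with eigenvalues $\mu_1\ge\mu_2\ge\dots\ge\mu_n=0$. $S_k(G)=\sum_{i=1}^k\mu_i$ is the sum of the $k$ largest Laplacian eigenvalues. A $c$-cyclic graph is a connected graph with $n'$ vertices and $n'+c-1$ edges. A trivial component is an isolated vertex; a non-trivial component is a component with at least two vertices. *)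

theory Defs
  imports "Graph_Theory.Graph_Theory" "Jordan_Normal_Form.Char_Poly"
begin

text \<open>
  Finite simple graphs are the \<open>pair_graph\<close>s of Graph\_Theory: finite, loop-free, symmetric
  digraphs without parallel arcs. An undirected edge \<open>uv\<close> is the pair of arcs \<open>(u,v)\<close>, \<open>(v,u)\<close>,
  so the out-degree of a vertex is its degree, the strongly connected components (\<open>sccs\<close>) are
  the connected components, and edges are counted as two-element vertex sets rather than as arcs.
\<close>

definition edge_set :: "('a, 'b) pre_digraph \<Rightarrow> 'a set set" where
  "edge_set G = (\<lambda>e. {tail G e, head G e}) ` arcs G"

text \<open>
  Rows and columns are indexed by the positions of the list \<open>vs\<close>, which is meant to enumerate
  the vertices without repetition.
\<close>

definition adjacency_mat :: "'a pair_pre_digraph \<Rightarrow> 'a list \<Rightarrow> real mat" where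
  "adjacency_mat G vs = mat (length vs) (length vs)
     (\<lambda>(i, j). if (vs ! i, vs ! j) \<in> parcs G then 1 else 0)"

definition degree_mat :: "'a pair_pre_digraph \<Rightarrow> 'a list \<Rightarrow> real mat" where
  "degree_mat G vs = mat (length vs) (length vs)
     (\<lambda>(i, j). if i = j then real (out_degree G (vs ! i)) else 0)"

definition laplacian_mat :: "'a pair_pre_digraph \<Rightarrow> 'a list \<Rightarrow> real mat" where
  "laplacian_mat G vs = degree_mat G vs - adjacency_mat G vs"

text \<open>
  The list \<open>[\<mu>\<^sub>1, \<dots>, \<mu>\<^sub>n]\<close>, non-increasing and with algebraic multiplicities. The Laplacian is real
  symmetric, so its characteristic polynomial splits over the reals and no eigenvalue is lost.
\<close>

definition laplacian_eigenvalues :: "'a pair_pre_digraph \<Rightarrow> 'a list \<Rightarrow> real list" where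
  "laplacian_eigenvalues G vs =
     rev (sorted_list_of_multiset (proots (char_poly (laplacian_mat G vs))))"

definition laplacian_sum :: "nat \<Rightarrow> 'a pair_pre_digraph \<Rightarrow> 'a list \<Rightarrow> real" where
  "laplacian_sum k G vs = sum_list (take k (laplacian_eigenvalues G vs))"

definition is_clique :: "'a pair_pre_digraph \<Rightarrow> 'a set \<Rightarrow> bool" where
  "is_clique G K \<longleftrightarrow> K \<subseteq> pverts G \<and> complete_digraph (card K) (with_proj G \<restriction> K)"

definition clique_number :: "'a pair_pre_digraph \<Rightarrow> nat" where
  "clique_number G = Max (card ` {K. is_clique G K})"

definition delete_clique_edges :: "'a pair_pre_digraph \<Rightarrow> 'a set \<Rightarrow> 'a pair_pre_digraph" where
  "delete_clique_edges G K = \<lparr> pverts = pverts G, parcs = parcs G - K \<times> K \<rparr>"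

definition nontrivial_components ::
    "'a pair_pre_digraph \<Rightarrow> ('a, 'a \<times> 'a) pre_digraph set" where
  "nontrivial_components G = {C \<in> pre_digraph.sccs (with_proj G). 2 \<le> card (verts C)}"

definition trivial_components ::
    "'a pair_pre_digraph \<Rightarrow> ('a, 'a \<times> 'a) pre_digraph set" where
  "trivial_components G = {C \<in> pre_digraph.sccs (with_proj G). card (verts C) = 1}"

definition c_cyclic :: "nat \<Rightarrow> ('a, 'b) pre_digraph \<Rightarrow> bool" where
  "c_cyclic c C \<longleftrightarrow> graph C \<and> connected C \<and>
     int (card (edge_set C)) = int (card (verts C)) + int c - 1"

end

theory Submission
  imports Defs "Jordan_Normal_Form.Schur_Decomposition"
begin

text \<open>
  By the spectral theorem the sum of the \<open>k\<close> largest Laplacian eigenvalues of \<open>G\<close> is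
  \<open>\<Sum>\<^sub>i \<Sum>\<^sub>x\<^sub>y (u\<^sub>i x - u\<^sub>i y)\<^sup>2\<close> for orthonormal \<open>u\<^sub>1, \<dots>, u\<^sub>k\<close>, the inner sum running over the edges \<open>xy\<close>.
  The clique edges contribute at most \<open>\<omega>\<close> for each \<open>i\<close>, and at most \<open>2\<close> each over all \<open>i\<close> by Bessel.
  The remaining edges \<open>E\<close> contribute at most \<open>2k + 2|E| - |V(E)|\<close>: the vertices they cover can be
  partitioned into stars contained in \<open>E\<close>; a star with \<open>s\<close> leaves has Laplacian at most \<open>2I + P\<close>
  with \<open>P\<close> of rank one and trace \<open>s - 1\<close>, and each further edge costs \<open>2\<close>. When the non-trivial components
  are \<open>c\<close>-cyclic, \<open>2|E| - |V(E)| = n - p + 2r(c - 1)\<close>.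
\<close>

subsection \<open>The spectral theorem for real symmetric matrices\<close>

text \<open>For a complex eigenvector \<open>v\<close>, the bilinear product of
  \<open>?C *\<^sub>v v\<close> with \<open>conjugate v\<close> is evaluated twice: directly, and
  after moving the symmetric matrix to the other factor. The results differ only by replacing
  \<open>a\<close> with its conjugate.\<close>

lemma real_symmetric_eigenvalue_real:
  fixes A :: "real mat"
  assumes A: "A \<in> carrier_mat n n" and sym: "transpose_mat A = A"
    and ev: "eigenvalue (map_mat complex_of_real A) a"
  shows "of_real (Re a) = a"
proof -
  let ?C = "map_mat complex_of_real A"
  have C: "?C \<in> carrier_mat n n" using A by simp
  have symC: "transpose_mat ?C = ?C" using sym by (metis map_mat_transpose)
  obtain v where v: "v \<in> carrier_vec n" "v \<noteq> 0\<^sub>v n" and Cv: "?C *\<^sub>v v = a \<cdot>\<^sub>v v"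
    using ev A unfolding eigenvalue_def eigenvector_def by auto
  have cv: "conjugate v \<in> carrier_vec n" using v by simp
  \<comment> \<open>The entries are real, so conjugation passes through the matrix and
    \<open>conjugate v\<close> is an eigenvector for \<open>cnj a\<close>.\<close>
  have "?C *\<^sub>v conjugate v = conjugate (?C *\<^sub>v v)"
    using A v by (intro eq_vecI) (auto simp: scalar_prod_def cnj_sum)
  then have Ccv: "?C *\<^sub>v conjugate v = cnj a \<cdot>\<^sub>v conjugate v"
    unfolding Cv using v by (simp add: conjugate_smult_vec)
  have "a * (v \<bullet> conjugate v) = (?C *\<^sub>v v) \<bullet> conjugate v"
    unfolding Cv using v cv by simp
  also have "\<dots> = (transpose_mat ?C *\<^sub>v v) \<bullet> conjugate v" unfolding symC ..
  also have "\<dots> = v \<bullet> (?C *\<^sub>v conjugate v)"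
    by (rule transpose_vec_mult_scalar[OF C cv v(1)])
  also have "\<dots> = cnj a * (v \<bullet> conjugate v)" unfolding Ccv using v cv by simp
  finally have "a = cnj a"
    using conjugate_square_eq_0_vec[OF v(1)] v(2) by simp
  then show ?thesis by (metis Reals_cnj_iff of_real_Re)
qed

text \<open>Over the complex numbers the polynomial splits; its roots are eigenvalues, hence real,
  and injectivity of the embedding of polynomials pulls the factorization back.\<close>

lemma real_symmetric_char_poly_splits:
  fixes A :: "real mat"
  assumes A: "A \<in> carrier_mat n n" and sym: "transpose_mat A = A"
  shows "\<exists>es. char_poly A = (\<Prod>e\<leftarrow>es. [:- e, 1:]) \<and> length es = n"
proof -
  let ?C = "map_mat complex_of_real A"
  have C: "?C \<in> carrier_mat n n" using A by simp
  obtain as where as: "char_poly ?C = (\<Prod>a\<leftarrow>as. [:- a, 1:])" and len: "length as = n"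
    using char_poly_factorized[OF C] by blast
  have real: "of_real (Re a) = a" if "a \<in> set as" for a
  proof (rule real_symmetric_eigenvalue_real[OF A sym])
    show "eigenvalue ?C a"
      unfolding eigenvalue_root_char_poly[OF C] as using that
      by (auto simp: poly_prod_list prod_list_zero_iff o_def image_iff)
  qed
  interpret P: map_poly_inj_comm_ring_hom complex_of_real ..
  have "map_poly complex_of_real (char_poly A) = char_poly ?C"
    by (rule of_real_hom.char_poly_hom[OF A, symmetric])
  also have "\<dots> = (\<Prod>a\<leftarrow>as. map_poly complex_of_real [:- Re a, 1:])"
    unfolding as using real by (intro arg_cong[where f = prod_list] map_cong) auto
  also have "\<dots> = map_poly complex_of_real (\<Prod>e\<leftarrow>map Re as. [:- e, 1:])"
    by (simp add: P.hom_prod_list o_def)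
  finally have "char_poly A = (\<Prod>e\<leftarrow>map Re as. [:- e, 1:])"
    by (rule P.injectivity)
  then show ?thesis using len by (intro exI[of _ "map Re as"]) simp
qed

text \<open>Complete \<open>v\<close> to a basis, apply Gram-Schmidt, which leaves the first vector
  unchanged, and normalise the columns.\<close>

lemma orthogonal_mat_with_first_column:
  fixes v :: "real vec"
  assumes v: "v \<in> carrier_vec n" "v \<noteq> 0\<^sub>v n"
  shows "\<exists>W \<in> carrier_mat n n. transpose_mat W * W = 1\<^sub>m n \<and> (\<exists>c. col W 0 = c \<cdot>\<^sub>v v)"
proof -
  interpret cof_vec_space n "TYPE(real)" .
  define b where "b = basis_completion v"
  define ws where "ws = gram_schmidt n b"
  from basis_completion[OF v, folded b_def]
  have dist_b: "distinct b" and indep: "\<not> lin_dep (set b)" and b: "set b \<subseteq> carrier_vec n"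
    and hdb: "hd b = v" and len_b: "length b = n" by auto
  have n: "n \<noteq> 0" using v by auto
  then obtain vs where bv: "b = v # vs" using hdb len_b by (cases b) auto
  from gram_schmidt_result[OF b dist_b indep refl, folded ws_def]
  have ws: "set ws \<subseteq> carrier_vec n" "corthogonal ws" "length ws = n"
    by (auto simp: len_b)
  have hdws: "ws ! 0 = v"
    using gram_schmidt_hd[OF v(1), of vs, folded bv] ws(3) n
    unfolding ws_def by (metis hd_conv_nth list.size(3))
  have wsn: "ws ! i \<in> carrier_vec n" if "i < n" for i using ws that by auto
  \<comment> \<open>The equivalence also carries the diagonal case: no \<open>ws ! i\<close> has
    norm zero, so the scaling \<open>c\<close> is legitimate.\<close>
  have orth: "ws ! i \<bullet> ws ! j = 0 \<longleftrightarrow> i \<noteq> j" if "i < n" "j < n" for i j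
    using ws(2) that ws(3) unfolding corthogonal_def by simp
  define c where "c i = 1 / sqrt (ws ! i \<bullet> ws ! i)" for i
  define W where "W = mat n n (\<lambda>(i, j). c j * (ws ! j $ i))"
  have W: "W \<in> carrier_mat n n" unfolding W_def by simp
  have col: "col W j = c j \<cdot>\<^sub>v (ws ! j)" if "j < n" for j
    using that wsn[OF that] unfolding W_def by (intro eq_vecI) auto
  have "transpose_mat W * W = 1\<^sub>m n"
  proof (intro eq_matI)
    fix i j assume "i < dim_row (1\<^sub>m n :: real mat)" "j < dim_col (1\<^sub>m n :: real mat)"
    then have ij: "i < n" "j < n" by auto
    have "(transpose_mat W * W) $$ (i, j) = c i * (c j * (ws ! i \<bullet> ws ! j))"
      using ij W wsn[OF ij(1)] wsn[OF ij(2)] by (simp add: col)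
    also have "\<dots> = (if i = j then 1 else 0)"
    proof (cases "i = j")
      case True
      have "ws ! i \<bullet> ws ! i \<ge> 0" by (auto simp: scalar_prod_def intro: sum_nonneg)
      moreover have "ws ! i \<bullet> ws ! i \<noteq> 0" using orth[OF ij(1) ij(1)] by simp
      ultimately show ?thesis using True by (simp add: c_def)
    qed (use orth[OF ij] in simp)
    finally show "(transpose_mat W * W) $$ (i, j) = 1\<^sub>m n $$ (i, j)" using ij by simp
  qed (use W in auto)
  moreover have "col W 0 = c 0 \<cdot>\<^sub>v v" using col[of 0] n hdws by simp
  ultimately show ?thesis using W by blast
qed

text \<open>Deflation: an orthogonal change of basis starting with an eigenvector for the head of
  \<open>es\<close> leaves a symmetric block for the tail. The diagonal follows the order of
  \<open>es\<close>, so the eigenvalues can later be taken in non-increasing order.\<close>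

lemma real_symmetric_orthogonal_diagonal:
  fixes A :: "real mat"
  assumes "A \<in> carrier_mat n n" "transpose_mat A = A" "char_poly A = (\<Prod>e\<leftarrow>es. [:- e, 1:])"
  shows "\<exists>U \<in> carrier_mat n n. transpose_mat U * U = 1\<^sub>m n \<and> diag_mat (transpose_mat U * A * U) = es"
  using assms
proof (induction es arbitrary: n A)
  case Nil
  then have "n = 0" using degree_monic_char_poly[of A n] by auto
  then show ?case by (intro bexI[of _ "1\<^sub>m 0"]) (auto simp: diag_mat_def)
next
  case (Cons e es n A)
  note A = Cons.prems(1) and sym = Cons.prems(2)
  let ?n1 = "n - 1"
  have cp: "char_poly A = [:- e, 1:] * (\<Prod>e\<leftarrow>es. [:- e, 1:])" using Cons.prems by simp
  have "eigenvalue A e" unfolding eigenvalue_root_char_poly[OF A] cp by simp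
  then obtain v where v: "v \<in> carrier_vec n" "v \<noteq> 0\<^sub>v n" and Av: "A *\<^sub>v v = e \<cdot>\<^sub>v v"
    using A unfolding eigenvalue_def eigenvector_def by auto
  have n: "n = 1 + ?n1" "n > 0" using v by (cases n; auto)+
  obtain W c where W: "W \<in> carrier_mat n n" and WW: "transpose_mat W * W = 1\<^sub>m n"
    and colW: "col W 0 = c \<cdot>\<^sub>v v"
    using orthogonal_mat_with_first_column[OF v] by blast
  let ?W = "transpose_mat W"
  have W': "?W \<in> carrier_mat n n" using W by simp
  have WW': "W * ?W = 1\<^sub>m n" by (rule mat_mult_left_right_inverse[OF W' W WW])
  define A' where "A' = ?W * A * W"
  have A': "A' \<in> carrier_mat n n" unfolding A'_def using A W by simp
  have "similar_mat_wit A' A ?W W"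
    by (rule similar_mat_witI[of _ _ n]) (use A A' W W' WW WW' in \<open>auto simp: A'_def\<close>)
  then have cp': "char_poly A' = char_poly A"
    by (intro char_poly_similar) (auto simp: similar_mat_def)
  have symA': "transpose_mat A' = A'"
  proof -
    have "transpose_mat A' = transpose_mat W * transpose_mat (?W * A)"
      unfolding A'_def by (rule transpose_mult[of _ n n _ n]) (use A W in auto)
    also have "transpose_mat (?W * A) = transpose_mat A * W"
      using transpose_mult[OF W' A] by simp
    also have "?W * (transpose_mat A * W) = A'"
      unfolding A'_def sym using A W W' by (simp add: assoc_mult_mat[of _ n n _ n _ n])
    finally show ?thesis .
  qed
  \<comment> \<open>The first column of \<open>W\<close> is a multiple of the eigenvector
    \<open>v\<close>, and \<open>?W\<close> sends that column to the first unit vector.\<close>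
  have col0: "col A' 0 = e \<cdot>\<^sub>v unit_vec n 0"
  proof -
    have "col A' 0 = (?W * A) *\<^sub>v col W 0"
      unfolding A'_def by (rule col_mult2[of _ n n _ n]) (use A W n in auto)
    also have "\<dots> = ?W *\<^sub>v (A *\<^sub>v col W 0)"
      by (rule assoc_mult_mat_vec[of _ n n _ n]) (use A W n in auto)
    also have "A *\<^sub>v col W 0 = e \<cdot>\<^sub>v col W 0"
      unfolding colW using A v Av by (simp add: mult_mat_vec[OF A v(1)] smult_smult_assoc mult.commute)
    also have "?W *\<^sub>v (e \<cdot>\<^sub>v col W 0) = e \<cdot>\<^sub>v (?W *\<^sub>v col W 0)"
      by (rule mult_mat_vec[OF W']) (use W n in auto)
    also have "?W *\<^sub>v col W 0 = col (?W * W) 0"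
      by (rule col_mult2[symmetric, OF W' W]) (use n in auto)
    also have "\<dots> = unit_vec n 0" unfolding WW using n by simp
    finally show ?thesis .
  qed
  \<comment> \<open>Symmetry transfers the shape of the first column to the first row, which makes
    \<open>A'\<close> block diagonal.\<close>
  have A'0: "A' $$ (i, 0) = (if i = 0 then e else 0)" "A' $$ (0, i) = (if i = 0 then e else 0)"
    if "i < n" for i
  proof -
    have "A' $$ (i, 0) = col A' 0 $ i" using A' that n by simp
    then show "A' $$ (i, 0) = (if i = 0 then e else 0)" unfolding col0 using that n by simp
    moreover have "A' $$ (0, i) = A' $$ (i, 0)"
      using symA' A' that n by (metis carrier_matD index_transpose_mat(1))
    ultimately show "A' $$ (0, i) = (if i = 0 then e else 0)" by simp
  qed
  define A3 where "A3 = mat ?n1 ?n1 (\<lambda>(i, j). A' $$ (Suc i, Suc j))"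
  let ?E = "mat 1 1 (\<lambda>_. e)"
  let ?blk = "\<lambda>a D. four_block_mat a (0\<^sub>m 1 ?n1) (0\<^sub>m ?n1 1) (D :: real mat)"
  have A3: "A3 \<in> carrier_mat ?n1 ?n1" unfolding A3_def by simp
  have blk: "A' = ?blk ?E A3"
    by (rule eq_matI) (use A' A'0 n in \<open>auto simp: A3_def\<close>)
  have "transpose_mat A3 = A3"
  proof (rule eq_matI)
    fix i j assume "i < dim_row A3" "j < dim_col A3"
    then have ij: "Suc i < n" "Suc j < n" "i < ?n1" "j < ?n1" using A3 by auto
    then have "A' $$ (Suc j, Suc i) = A' $$ (Suc i, Suc j)"
      using symA' A' by (metis carrier_matD index_transpose_mat(1))
    then show "transpose_mat A3 $$ (i, j) = A3 $$ (i, j)" using ij by (simp add: A3_def)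
  qed (use A3 in auto)
  moreover have "char_poly A3 = (\<Prod>e\<leftarrow>es. [:- e, 1:])"
  \<comment> \<open>The characteristic polynomial of the blocks is a product; cancelling the
    non-zero factor of \<open>e\<close> leaves the one of \<open>A3\<close>.\<close>
  proof -
    have "char_poly A' = char_poly ?E * char_poly A3"
      unfolding blk by (rule char_poly_four_block_zeros_col[OF _ _ A3]) auto
    moreover have "char_poly ?E = [:- e, 1:]" by (simp add: char_poly_defs det_def sign_def)
    ultimately show ?thesis using cp cp' by (metis mult_cancel_left pCons_eq_0_iff zero_neq_one)
  qed
  ultimately obtain U where U: "U \<in> carrier_mat ?n1 ?n1" and UU: "transpose_mat U * U = 1\<^sub>m ?n1"
    and diag: "diag_mat (transpose_mat U * A3 * U) = es"
    using Cons.IH[OF A3] by blast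
  \<comment> \<open>The diagonalizer of the small block, extended by 1 in the corner;
    \<open>W * F\<close> then diagonalizes \<open>A\<close>.\<close>
  define F where "F = ?blk (1\<^sub>m 1) U"
  have F: "F \<in> carrier_mat n n" unfolding F_def using U n by (metis four_block_carrier_mat one_carrier_mat)
  have F': "transpose_mat F = ?blk (1\<^sub>m 1) (transpose_mat U)"
    unfolding F_def using U by (subst transpose_four_block_mat[of _ 1 1 _ ?n1 _ ?n1]) auto
  have mult: "?blk a D * ?blk a' D' = ?blk (a * a') (D * D')"
    if "a \<in> carrier_mat 1 1" "a' \<in> carrier_mat 1 1" "D \<in> carrier_mat ?n1 ?n1" "D' \<in> carrier_mat ?n1 ?n1"
    for a a' D D'
    using that by (subst mult_four_block_mat[of _ 1 1 _ ?n1 _ ?n1]) auto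
  have FF: "transpose_mat F * F = 1\<^sub>m n"
  proof -
    have "transpose_mat F * F = ?blk (1\<^sub>m 1) (1\<^sub>m ?n1)"
      unfolding F' unfolding F_def using U UU by (subst mult) auto
    also have "\<dots> = 1\<^sub>m n" using n by (intro eq_matI) auto
    finally show ?thesis .
  qed
  have FAF: "transpose_mat F * A' * F = ?blk ?E (transpose_mat U * A3 * U)"
  proof -
    have "transpose_mat F * A' = ?blk (1\<^sub>m 1 * ?E) (transpose_mat U * A3)"
      unfolding F' blk using U A3 by (intro mult) auto
    moreover have "\<dots> * F = ?blk (1\<^sub>m 1 * ?E * 1\<^sub>m 1) (transpose_mat U * A3 * U)"
      unfolding F_def using U A3 by (intro mult) auto
    moreover have "1\<^sub>m 1 * ?E * 1\<^sub>m 1 = ?E" by (intro eq_matI) (auto simp: scalar_prod_def)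
    ultimately show ?thesis by simp
  qed
  have trans: "transpose_mat (W * F) = transpose_mat F * ?W" by (rule transpose_mult[OF W F])
  have FT: "transpose_mat F \<in> carrier_mat n n" using F by simp
  have "transpose_mat (W * F) * (W * F) = transpose_mat F * (?W * W) * F"
    unfolding trans using FT F W W' by (simp add: assoc_mult_mat[of _ n n _ n _ n])
  also have "\<dots> = 1\<^sub>m n" unfolding WW using FT F FF by simp
  finally have 1: "transpose_mat (W * F) * (W * F) = 1\<^sub>m n" .
  have "transpose_mat (W * F) * A * (W * F) = transpose_mat F * A' * F"
    unfolding trans A'_def using FT F W W' A by (simp add: assoc_mult_mat[of _ n n _ n _ n])
  also have "diag_mat \<dots> = e # es"
    unfolding FAF using diag U A3
    by (subst diag_four_block_mat[of _ 1 _ ?n1]) (auto simp: diag_mat_def)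
  finally show ?case using 1 W F by (intro bexI[of _ "W * F"]) auto
qed

subsection \<open>Orthonormal families and edge forms\<close>

text \<open>Vectors are functions on the vertices, so that forms indexed by edges can be evaluated
  on them without enumerating the vertices.\<close>

definition orthonormal_on :: "'a set \<Rightarrow> nat \<Rightarrow> (nat \<Rightarrow> 'a \<Rightarrow> real) \<Rightarrow> bool" where
  "orthonormal_on V k u \<longleftrightarrow>
     (\<forall>i<k. \<forall>j<k. (\<Sum>v\<in>V. u i v * u j v) = (if i = j then 1 else 0))"

lemma orthonormal_on_norm:
  assumes "orthonormal_on V k u" "i < k"
  shows "(\<Sum>v\<in>V. (u i v)\<^sup>2) = 1"
  using assms by (simp add: orthonormal_on_def power2_eq_square)

text \<open>The squared distance from \<open>x\<close> to its projection onto the span of the family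
  is non-negative.\<close>

lemma bessel:
  assumes on: "orthonormal_on V k u"
  shows "(\<Sum>i<k. (\<Sum>v\<in>V. x v * u i v)\<^sup>2) \<le> (\<Sum>v\<in>V. (x v)\<^sup>2)"
proof -
  define c where "c i = (\<Sum>v\<in>V. x v * u i v)" for i
  have cross: "(\<Sum>v\<in>V. x v * (\<Sum>i<k. c i * u i v)) = (\<Sum>i<k. (c i)\<^sup>2)"
  proof -
    have "(\<Sum>v\<in>V. x v * (\<Sum>i<k. c i * u i v)) = (\<Sum>v\<in>V. \<Sum>i<k. c i * (x v * u i v))"
      by (simp add: sum_distrib_left mult_ac)
    also have "\<dots> = (\<Sum>i<k. \<Sum>v\<in>V. c i * (x v * u i v))" by (rule sum.swap)
    also have "\<dots> = (\<Sum>i<k. (c i)\<^sup>2)"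
      by (simp add: sum_distrib_left[symmetric] c_def power2_eq_square)
    finally show ?thesis .
  qed
  have square: "(\<Sum>v\<in>V. (\<Sum>i<k. c i * u i v)\<^sup>2) = (\<Sum>i<k. (c i)\<^sup>2)"
  proof -
    have "(\<Sum>v\<in>V. (\<Sum>i<k. c i * u i v)\<^sup>2) = (\<Sum>v\<in>V. \<Sum>i<k. \<Sum>j<k. c i * c j * (u i v * u j v))"
      by (simp add: power2_eq_square sum_product mult_ac)
    also have "\<dots> = (\<Sum>i<k. \<Sum>v\<in>V. \<Sum>j<k. c i * c j * (u i v * u j v))"
      by (rule sum.swap)
    also have "\<dots> = (\<Sum>i<k. \<Sum>j<k. \<Sum>v\<in>V. c i * c j * (u i v * u j v))"
      by (intro sum.cong refl sum.swap)
    also have "\<dots> = (\<Sum>i<k. \<Sum>j<k. c i * c j * (if i = j then 1 else 0))"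
      using on by (intro sum.cong refl) (simp add: sum_distrib_left[symmetric] orthonormal_on_def)
    also have "\<dots> = (\<Sum>i<k. (c i)\<^sup>2)"
      by (intro sum.cong refl) (simp add: power2_eq_square if_distrib cong: if_cong)
    finally show ?thesis .
  qed
  have "0 \<le> (\<Sum>v\<in>V. (x v - (\<Sum>i<k. c i * u i v))\<^sup>2)" by (intro sum_nonneg) simp
  also have "\<dots> = (\<Sum>v\<in>V. (x v)\<^sup>2) - 2 * (\<Sum>v\<in>V. x v * (\<Sum>i<k. c i * u i v))
      + (\<Sum>v\<in>V. (\<Sum>i<k. c i * u i v)\<^sup>2)"
    by (simp add: power2_diff sum.distrib sum_subtractf sum_distrib_left mult_ac)
  finally show ?thesis unfolding cross square by (simp add: c_def)
qed

text \<open>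
  For an edge \<open>e = {x, y}\<close> this is \<open>(f x - f y)\<^sup>2\<close>, written without choosing an orientation.
\<close>

definition edge_form :: "'a set \<Rightarrow> ('a \<Rightarrow> real) \<Rightarrow> real" where
  "edge_form e f = 2 * (\<Sum>v\<in>e. (f v)\<^sup>2) - (\<Sum>v\<in>e. f v)\<^sup>2"

lemma edge_form_pair: "x \<noteq> y \<Longrightarrow> edge_form {x, y} f = (f x - f y)\<^sup>2"
  by (simp add: edge_form_def power2_eq_square algebra_simps)

text \<open>Bessel's inequality for the incidence vector of the edge, whose squared length is 2, the
  trace of the Laplacian of one edge.\<close>

lemma edge_form_trace:
  assumes V: "finite V" "x \<in> V" "y \<in> V" and on: "orthonormal_on V k u"
  shows "(\<Sum>i<k. (u i x - u i y)\<^sup>2) \<le> 2"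
proof (cases "x = y")
  case False
  let ?x = "\<lambda>v. (if v = x then 1 else 0) - (if v = y then 1 else 0) :: real"
  have "(\<Sum>v\<in>V. ?x v * f v) = f x - f y" for f
    using V by (simp add: left_diff_distrib sum_subtractf if_distrib[of "\<lambda>a. a * _"] cong: if_cong)
  moreover have "(\<Sum>v\<in>V. (?x v)\<^sup>2) = 2"
  proof -
    have "(?x v)\<^sup>2 = (if v = x then 1 else 0) + (if v = y then 1 else 0)" for v
      using False by simp
    then show ?thesis using V by (simp add: sum.distrib)
  qed
  ultimately show ?thesis using bessel[OF on, of ?x] by simp
qed simp

section \<open>The Laplacian of a star\<close>

lemma star_quadratic_form_le:
  fixes y T R :: real and s :: real
  assumes s: "s \<ge> 1" and T: "T\<^sup>2 \<le> s * R"
  shows "s * y\<^sup>2 - 2 * y * T + R \<le> 2 * (y\<^sup>2 + R) + (s - 1) / (s * (s + 1)) * (s * y - T)\<^sup>2"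
proof -
  \<comment> \<open>Here \<open>y\<close> is the value at the centre, and \<open>T\<close> and
    \<open>R\<close> are the sum and the sum of squares over the \<open>s\<close> leaves. The gap is
    a square plus the Cauchy-Schwarz defect of the leaf values.\<close>
  have "2 * (y\<^sup>2 + R) + (s - 1) / (s * (s + 1)) * (s * y - T)\<^sup>2 - (s * y\<^sup>2 - 2 * y * T + R)
     = 2 / (s + 1) * (y + T)\<^sup>2 + (s * R - T\<^sup>2) / s"
    using s by (simp add: divide_simps power2_eq_square) (simp add: algebra_simps)
  moreover have "\<dots> \<ge> 0" using s T by (intro add_nonneg_nonneg mult_nonneg_nonneg) auto
  ultimately show ?thesis by linarith
qed

text \<open>The top eigenvector of the star is \<open>s\<close> at the centre and -1 at each leaf,
  with squared length \<open>s * (s + 1)\<close> and eigenvalue \<open>s + 1\<close>. The last term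
  is therefore \<open>s - 1\<close> times the projection onto it, the excess of that eigenvalue over
  2; the other eigenvalues are at most 1.\<close>

lemma star_edge_form_le:
  assumes B: "finite B" "B \<noteq> {}" "a \<notin> B"
  defines "s \<equiv> real (card B)"
  shows "(\<Sum>b\<in>B. edge_form {a, b} f)
    \<le> 2 * (\<Sum>v\<in>insert a B. (f v)\<^sup>2) + (s - 1) / (s * (s + 1)) * (s * f a - (\<Sum>b\<in>B. f b))\<^sup>2"
proof -
  have "(\<Sum>b\<in>B. edge_form {a, b} f) = (\<Sum>b\<in>B. (f a)\<^sup>2 - 2 * f a * f b + (f b)\<^sup>2)"
    using B by (intro sum.cong refl, subst edge_form_pair) (auto simp: power2_diff)
  also have "\<dots> = s * (f a)\<^sup>2 - 2 * f a * (\<Sum>b\<in>B. f b) + (\<Sum>b\<in>B. (f b)\<^sup>2)"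
    by (simp add: sum.distrib sum_subtractf sum_distrib_left s_def)
  also have "\<dots> \<le> 2 * ((f a)\<^sup>2 + (\<Sum>b\<in>B. (f b)\<^sup>2)) + (s - 1) / (s * (s + 1)) * (s * f a - (\<Sum>b\<in>B. f b))\<^sup>2"
  proof (rule star_quadratic_form_le)
    let ?T = "\<Sum>b\<in>B. f b" and ?R = "\<Sum>b\<in>B. (f b)\<^sup>2"
    show s: "s \<ge> 1" using B by (simp add: s_def Suc_le_eq card_gt_0_iff)
    \<comment> \<open>Cauchy-Schwarz for the leaf values, from the scaled variance around their mean
      \<open>?T / s\<close>.\<close>
    have "0 \<le> (\<Sum>b\<in>B. (s * f b - ?T)\<^sup>2)" by (intro sum_nonneg) simp
    also have "\<dots> = s\<^sup>2 * ?R - 2 * (s * ?T) * ?T + s * ?T\<^sup>2"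
      by (simp add: power2_diff power_mult_distrib sum.distrib sum_subtractf sum_distrib_left[symmetric]
          sum_distrib_right[symmetric] s_def mult_ac)
    also have "\<dots> = s * (s * ?R - ?T\<^sup>2)" by (simp add: power2_eq_square algebra_simps)
    finally show "?T\<^sup>2 \<le> s * ?R" using s by (simp add: zero_le_mult_iff)
  qed
  finally show ?thesis using B by simp
qed

text \<open>Bessel's inequality for the unnormalised top eigenvector \<open>?x\<close> of the star;
  its squared length \<open>s * (s + 1)\<close> cancels the denominator.\<close>

lemma star_trace:
  assumes B: "finite B" "B \<noteq> {}" "a \<notin> B" and V: "finite V" "insert a B \<subseteq> V"
    and on: "orthonormal_on V k u"
  defines "s \<equiv> real (card B)"
  shows "(\<Sum>i<k. (s - 1) / (s * (s + 1)) * (s * u i a - (\<Sum>b\<in>B. u i b))\<^sup>2) \<le> s - 1"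
proof -
  let ?x = "\<lambda>v. (if v = a then s else 0) - (if v \<in> B then 1 else 0) :: real"
  have B': "V \<inter> B = B" using V by auto
  have s: "s \<ge> 1" using B by (simp add: s_def Suc_le_eq card_gt_0_iff)
  have "(\<Sum>v\<in>V. ?x v * f v) = s * f a - (\<Sum>b\<in>B. f b)" for f
    using V B' by (simp add: left_diff_distrib sum_subtractf if_distrib[of "\<lambda>a. a * _"]
        sum.inter_restrict[symmetric] cong: if_cong)
  moreover have "(\<Sum>v\<in>V. (?x v)\<^sup>2) = s * (s + 1)"
  proof -
    have "(?x v)\<^sup>2 = (if v = a then s\<^sup>2 else 0) + (if v \<in> B then 1 else 0)" for v
      using B by auto
    then show ?thesis using V B' by (simp add: sum.distrib sum.inter_restrict[symmetric] s_def
        power2_eq_square algebra_simps)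
  qed
  ultimately have "(\<Sum>i<k. (s * u i a - (\<Sum>b\<in>B. u i b))\<^sup>2) \<le> s * (s + 1)"
    using bessel[OF on, of ?x] by simp
  then have "(s - 1) / (s * (s + 1)) * (\<Sum>i<k. (s * u i a - (\<Sum>b\<in>B. u i b))\<^sup>2)
      \<le> (s - 1) / (s * (s + 1)) * (s * (s + 1))"
    using s by (intro mult_left_mono) auto
  then show ?thesis using s by (simp add: sum_distrib_left)
qed

section \<open>Reduction of an edge set to stars and redundant edges\<close>

lemma finite_Union_edges:
  assumes "finite E" "\<And>e. e \<in> E \<Longrightarrow> card e = 2"
  shows "finite (\<Union>E)"
  using assms(1)
proof (rule finite_Union)
  show "finite e" if "e \<in> E" for e using assms(2)[OF that] by (intro card_ge_0_finite) simp
qed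

text \<open>
  In an edge set without redundant edges every edge has an endpoint of degree one, so the edges
  at a suitable vertex form a star that is a connected component.
\<close>

lemma minimal_edge_cover_star:
  assumes fin: "finite E" and ne: "E \<noteq> {}" and card: "\<And>e. e \<in> E \<Longrightarrow> card e = 2"
    and min: "\<And>e. e \<in> E \<Longrightarrow> \<Union>(E - {e}) \<noteq> \<Union>E"
  obtains a B where "finite B" "B \<noteq> {}" "a \<notin> B" "(\<lambda>b. {a, b}) ` B \<subseteq> E"
    "\<Union>(E - (\<lambda>b. {a, b}) ` B) \<inter> insert a B = {}"
proof -
  \<comment> \<open>Removing \<open>e\<close> uncovers some vertex, and this vertex lies on no other
    edge.\<close>
  have endpoint: "\<exists>z\<in>e. \<forall>e'\<in>E. z \<in> e' \<longrightarrow> e' = e" if "e \<in> E" for e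
    using min[OF that] that by blast
  obtain e where e: "e \<in> E" using ne by blast
  \<comment> \<open>The private endpoint \<open>y\<close> becomes a leaf, and the other endpoint
    \<open>a\<close> the centre of the star.\<close>
  obtain y where y: "y \<in> e" "\<And>e'. e' \<in> E \<Longrightarrow> y \<in> e' \<Longrightarrow> e' = e" using endpoint[OF e] by blast
  obtain a where a: "e = {a, y}" "a \<noteq> y"
    using card[OF e] y(1) by (auto simp: card_2_iff)
  define B where "B = {b. {a, b} \<in> E}"
  have "finite (\<Union>E)" using fin card by (rule finite_Union_edges)
  then have finB: "finite B" by (rule rev_finite_subset) (auto simp: B_def)
  have neB: "B \<noteq> {}" using a e by (auto simp: B_def)
  have aB: "a \<notin> B" using card[of "{a, a}"] by (auto simp: B_def)
  have sub: "(\<lambda>b. {a, b}) ` B \<subseteq> E" by (auto simp: B_def)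
  have aS: "a \<notin> e'" if e': "e' \<in> E - (\<lambda>b. {a, b}) ` B" for e'
  proof
    assume "a \<in> e'"
    moreover obtain p q where "e' = {p, q}" using card[of e'] e' by (auto simp: card_2_iff)
    ultimately obtain b where b: "e' = {a, b}" by blast
    then have "b \<in> B" using e' by (simp add: B_def)
    then show False using e' b by blast
  qed
  have bS: "b \<notin> e'" if b: "b \<in> B" and e': "e' \<in> E - (\<lambda>b. {a, b}) ` B" for e' b
  proof
    assume be: "b \<in> e'"
    have ab: "{a, b} \<in> E" using b by (simp add: B_def)
    obtain z where z: "z \<in> {a, b}" "\<And>e'. e' \<in> E \<Longrightarrow> z \<in> e' \<Longrightarrow> e' = {a, b}"
      using endpoint[OF ab] by blast
    \<comment> \<open>If the private endpoint of \<open>{a, b}\<close> is \<open>a\<close> instead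
      of \<open>b\<close>, then \<open>e\<close> itself must be \<open>{a, b}\<close>; so
      \<open>b\<close> is \<open>y\<close>, which is private.\<close>
    have "e' = {a, b}"
    proof (cases "z = b")
      case True
      then show ?thesis using z(2) be e' by blast
    next
      case False
      then have "z = a" using z(1) by simp
      then have "e = {a, b}" using z(2)[OF e] a by simp
      then have "b = y" using a by (auto simp: doubleton_eq_iff)
      then show ?thesis using y(2) be e' \<open>e = {a, b}\<close> by blast
    qed
    then show False using b e' by blast
  qed
  have disj: "\<Union>(E - (\<lambda>b. {a, b}) ` B) \<inter> insert a B = {}" using aS bS by blast
  show thesis by (rule that[OF finB neB aB sub disj])
qed

text \<open>The Laplacian of \<open>E\<close> lies below \<open>2I + Q\<close> on the covered
  vertices. The trace of \<open>Q\<close> is measured through orthonormal families on any larger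
  vertex set, since the eigenvectors live on the whole graph.\<close>

definition edge_majorant :: "'a set set \<Rightarrow> (('a \<Rightarrow> real) \<Rightarrow> real) \<Rightarrow> bool" where
  "edge_majorant E Q \<longleftrightarrow>
    (\<forall>f. (\<Sum>e\<in>E. edge_form e f) \<le> 2 * (\<Sum>v\<in>\<Union>E. (f v)\<^sup>2) + Q f) \<and>
    (\<forall>V k u. finite V \<and> \<Union>E \<subseteq> V \<and> orthonormal_on V k u \<longrightarrow>
       (\<Sum>i<k. Q (u i)) \<le> 2 * real (card E) - real (card (\<Union>E)))"

lemma edge_majorant_form_le:
  "edge_majorant E Q \<Longrightarrow> (\<Sum>e\<in>E. edge_form e f) \<le> 2 * (\<Sum>v\<in>\<Union>E. (f v)\<^sup>2) + Q f"
  by (simp add: edge_majorant_def)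

lemma edge_majorant_trace_le:
  "edge_majorant E Q \<Longrightarrow> finite V \<Longrightarrow> \<Union>E \<subseteq> V \<Longrightarrow> orthonormal_on V k u \<Longrightarrow>
     (\<Sum>i<k. Q (u i)) \<le> 2 * real (card E) - real (card (\<Union>E))"
  by (simp add: edge_majorant_def)

text \<open>Induction on the number of edges. A redundant edge leaves the covered vertices unchanged
  and raises the trace budget by 2, its own trace. Otherwise a star with \<open>s\<close> leaves
  splits off, with \<open>s\<close> edges and \<open>s + 1\<close> vertices, raising the budget by
  \<open>2s - (s + 1) = s - 1\<close>, the trace of its rank-one term.\<close>

lemma edge_majorant_exists:
  assumes "finite E" "\<And>e. e \<in> E \<Longrightarrow> card e = 2"
  shows "\<exists>Q. edge_majorant E Q"
  using assms
proof (induction "card E" arbitrary: E rule: less_induct)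
  case (less E)
  note fin = less.prems(1) and card = less.prems(2)
  consider "E = {}" | e where "e \<in> E" "\<Union>(E - {e}) = \<Union>E"
    | "E \<noteq> {}" "\<And>e. e \<in> E \<Longrightarrow> \<Union>(E - {e}) \<noteq> \<Union>E" by blast
  then show ?case
  proof cases
    case 1
    then have "edge_majorant E (\<lambda>_. 0)" by (simp add: edge_majorant_def)
    then show ?thesis by blast
  next
    case (2 e)
    have lt: "card (E - {e}) < card E" using fin 2(1) by (rule card_Diff1_less)
    have cE: "card E = Suc (card (E - {e}))" using fin 2 by (metis card.remove)
    obtain Q where "edge_majorant (E - {e}) Q"
      using less.hyps[OF lt] fin card by auto
    note Q = edge_majorant_form_le[OF this] and tr = edge_majorant_trace_le[OF this]
    obtain x y where xy: "e = {x, y}" "x \<noteq> y" using card[OF 2(1)] by (auto simp: card_2_iff)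
    show ?thesis
      unfolding edge_majorant_def
    \<comment> \<open>The vertices of \<open>e\<close> already carry their term \<open>2I\<close>,
      so its whole form goes into \<open>Q\<close>.\<close>
    proof (intro exI[of _ "\<lambda>f. Q f + edge_form e f"] conjI allI impI)
      fix f show "(\<Sum>e\<in>E. edge_form e f) \<le> 2 * (\<Sum>v\<in>\<Union>E. (f v)\<^sup>2) + (Q f + edge_form e f)"
        using Q[of f] 2(2) by (simp add: sum.remove[OF fin 2(1)])
    next
      fix V k u assume *: "finite V \<and> \<Union>E \<subseteq> V \<and> orthonormal_on V k u"
      have "(\<Sum>i<k. edge_form e (u i)) \<le> 2"
        unfolding xy(1) edge_form_pair[OF xy(2)]
        using * 2(1) xy by (intro edge_form_trace[of V]) auto
      then show "(\<Sum>i<k. Q (u i) + edge_form e (u i)) \<le> 2 * real (card E) - real (card (\<Union>E))"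
        using tr[of V k u] * cE 2(2) by (simp add: sum.distrib)
    qed
  next
    case 3
    obtain a B where B: "finite B" "B \<noteq> {}" "a \<notin> B" and S: "(\<lambda>b. {a, b}) ` B \<subseteq> E"
      and disj: "\<Union>(E - (\<lambda>b. {a, b}) ` B) \<inter> insert a B = {}"
      by (rule minimal_edge_cover_star[OF fin 3(1) card 3(2)])
    define S where "S = (\<lambda>b. {a, b}) ` B"
    define s where "s = real (card B)"
    note SE = S[folded S_def] and disj = disj[folded S_def]
    have inj: "inj_on (\<lambda>b. {a, b}) B" by (auto simp: inj_on_def doubleton_eq_iff)
    have cS: "card S = card B" unfolding S_def by (rule card_image[OF inj])
    have finS: "finite S" using B by (simp add: S_def)
    have US: "\<Union>S = insert a B" using B by (auto simp: S_def)
    have UE: "\<Union>E = insert a B \<union> \<Union>(E - S)" using SE US by blast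
    have finU: "finite (\<Union>(E - S))" using fin card by (intro finite_Union_edges) auto
    have "S \<noteq> {}" using B by (simp add: S_def)
    then have lt: "card (E - S) < card E" using fin SE by (intro psubset_card_mono) auto
    have cE: "card E = card (E - S) + card B"
      using card_mono[OF fin SE] card_Diff_subset[OF finS SE] cS by simp
    have cUE: "card (\<Union>E) = card (\<Union>(E - S)) + card B + 1"
      unfolding UE using B finU disj by (subst card_Un_disjoint) auto
    obtain Q where "edge_majorant (E - S) Q"
      using less.hyps[OF lt] fin card by auto
    note Q = edge_majorant_form_le[OF this] and tr = edge_majorant_trace_le[OF this]
    let ?P = "\<lambda>f. (s - 1) / (s * (s + 1)) * (s * f a - (\<Sum>b\<in>B. f b))\<^sup>2"
    show ?thesis
      unfolding edge_majorant_def
    proof (intro exI[of _ "\<lambda>f. Q f + ?P f"] conjI allI impI)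
      fix f
      have "(\<Sum>e\<in>E. edge_form e f) = (\<Sum>e\<in>E - S. edge_form e f) + (\<Sum>b\<in>B. edge_form {a, b} f)"
        using sum.subset_diff[OF SE fin, of "\<lambda>e. edge_form e f"] inj
        by (simp add: S_def sum.reindex)
      \<comment> \<open>The star shares no vertex with the remaining edges, so the two terms
        \<open>2I\<close> add up without exceeding \<open>2I\<close>.\<close>
      moreover have "(\<Sum>v\<in>\<Union>E. (f v)\<^sup>2) = (\<Sum>v\<in>insert a B. (f v)\<^sup>2) + (\<Sum>v\<in>\<Union>(E - S). (f v)\<^sup>2)"
        unfolding UE using B finU disj by (intro sum.union_disjoint) auto
      ultimately show "(\<Sum>e\<in>E. edge_form e f) \<le> 2 * (\<Sum>v\<in>\<Union>E. (f v)\<^sup>2) + (Q f + ?P f)"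
        using Q[of f] star_edge_form_le[OF B, of f] unfolding s_def by linarith
    next
      fix V k u assume *: "finite V \<and> \<Union>E \<subseteq> V \<and> orthonormal_on V k u"
      have "(\<Sum>i<k. ?P (u i)) \<le> s - 1"
        unfolding s_def using * UE by (intro star_trace[OF B, of V]) auto
      moreover have "(\<Sum>i<k. Q (u i)) \<le> 2 * real (card (E - S)) - real (card (\<Union>(E - S)))"
        using * UE by (intro tr[of V]) auto
      ultimately show "(\<Sum>i<k. Q (u i) + ?P (u i)) \<le> 2 * real (card E) - real (card (\<Union>E))"
        using cE cUE by (simp add: sum.distrib s_def)
    qed
  qed
qed

text \<open>The part \<open>2I\<close> gives at most 2 for each unit vector, and the trace bound on
  \<open>Q\<close> gives the rest.\<close>

lemma sum_edge_form_le:
  assumes E: "finite E" "\<And>e. e \<in> E \<Longrightarrow> card e = 2" and V: "finite V" "\<Union>E \<subseteq> V"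
    and on: "orthonormal_on V k u"
  shows "(\<Sum>i<k. \<Sum>e\<in>E. edge_form e (u i)) \<le> 2 * real k + 2 * real (card E) - real (card (\<Union>E))"
proof -
  obtain Q where "edge_majorant E Q" using edge_majorant_exists[OF E] by blast
  note Q = edge_majorant_form_le[OF this] and tr = edge_majorant_trace_le[OF this V on]
  have "(\<Sum>e\<in>E. edge_form e (u i)) \<le> 2 + Q (u i)" if "i < k" for i
  proof -
    have "(\<Sum>v\<in>\<Union>E. (u i v)\<^sup>2) \<le> (\<Sum>v\<in>V. (u i v)\<^sup>2)" using V by (intro sum_mono2) auto
    then show ?thesis using Q[of "u i"] orthonormal_on_norm[OF on that] by linarith
  qed
  then have "(\<Sum>i<k. \<Sum>e\<in>E. edge_form e (u i)) \<le> (\<Sum>i<k. 2 + Q (u i))"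
    by (intro sum_mono) auto
  then show ?thesis using tr by (simp add: sum.distrib)
qed

subsection \<open>Laplacians and components\<close>

text \<open>The usual sum over edges of squared differences; the factor 2 appears because each
  undirected edge is a pair of arcs.\<close>

lemma laplacian_quadratic_form:
  assumes G: "pair_graph G" and vs: "distinct vs" "set vs = pverts G"
  shows "2 * (\<Sum>a<length vs. \<Sum>b<length vs. f (vs ! a) * laplacian_mat G vs $$ (a, b) * f (vs ! b))
    = (\<Sum>(x, y)\<in>parcs G. (f x - f y)\<^sup>2)"
proof -
  interpret pair_graph G by fact
  let ?V = "pverts G" and ?E = "parcs G" and ?n = "length vs"
  let ?I = "\<lambda>x y. if (x, y) \<in> ?E then 1 else 0 :: real"
  have fin: "finite ?V" and EV: "?E \<subseteq> ?V \<times> ?V"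
    using pair_finite_verts in_arcsD1 in_arcsD2 by auto
  have sum_nth: "(\<Sum>a<?n. g (vs ! a)) = (\<Sum>x\<in>?V. g x)" for g :: "'a \<Rightarrow> real"
    using sum.reindex_bij_betw[OF bij_betw_nth[OF vs(1) refl refl], of g] vs(2) by simp
  have sumE: "(\<Sum>(x, y)\<in>?E. g x y) = (\<Sum>x\<in>?V. \<Sum>y\<in>?V. ?I x y * g x y)" for g :: "'a \<Rightarrow> 'a \<Rightarrow> real"
  proof -
    have "(\<Sum>(x, y)\<in>?E. g x y) = (\<Sum>e\<in>?V \<times> ?V. if e \<in> ?E then case e of (x, y) \<Rightarrow> g x y else 0)"
      using fin EV by (simp add: sum.inter_restrict[symmetric] Int_absorb1)
    also have "\<dots> = (\<Sum>(x, y)\<in>?V \<times> ?V. ?I x y * g x y)"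
      by (intro sum.cong) auto
    finally show ?thesis by (simp add: sum.cartesian_product)
  qed
  have deg: "real (out_degree G x) = (\<Sum>y\<in>?V. ?I x y)" for x
  proof -
    have "out_arcs G x = Pair x ` {y \<in> ?V. (x, y) \<in> ?E}"
      using EV by (auto simp: out_arcs_def)
    then have "out_degree G x = card {y \<in> ?V. (x, y) \<in> ?E}"
      unfolding out_degree_def by (simp add: card_image inj_on_def)
    then show ?thesis using fin by (simp add: sum.If_cases Int_def)
  qed
  have entry: "laplacian_mat G vs $$ (a, b)
      = (if vs ! a = vs ! b then real (out_degree G (vs ! a)) else 0) - ?I (vs ! a) (vs ! b)"
    if "a < ?n" "b < ?n" for a b
    using that vs(1) by (simp add: laplacian_mat_def degree_mat_def adjacency_mat_def nth_eq_iff_index_eq)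
  let ?h = "\<lambda>x y. f x * ((if x = y then real (out_degree G x) else 0) - ?I x y) * f y"
  have "(\<Sum>a<?n. \<Sum>b<?n. f (vs ! a) * laplacian_mat G vs $$ (a, b) * f (vs ! b))
    = (\<Sum>a<?n. \<Sum>b<?n. ?h (vs ! a) (vs ! b))"
    by (intro sum.cong refl) (simp add: entry)
  also have "\<dots> = (\<Sum>a<?n. \<Sum>y\<in>?V. ?h (vs ! a) y)"
    by (intro sum.cong refl sum_nth)
  also have "\<dots> = (\<Sum>x\<in>?V. \<Sum>y\<in>?V. ?h x y)" by (rule sum_nth)
  also have "\<dots> = (\<Sum>x\<in>?V. (f x)\<^sup>2 * real (out_degree G x) - (\<Sum>y\<in>?V. ?I x y * (f x * f y)))"
  proof (intro sum.cong refl)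
    fix x assume x: "x \<in> ?V"
    have "(\<Sum>y\<in>?V. f x * ((if x = y then real (out_degree G x) else 0) - ?I x y) * f y)
      = (\<Sum>y\<in>?V. (if x = y then (f x)\<^sup>2 * real (out_degree G x) else 0) - ?I x y * (f x * f y))"
      by (intro sum.cong) (auto simp: power2_eq_square algebra_simps)
    then show "(\<Sum>y\<in>?V. f x * ((if x = y then real (out_degree G x) else 0) - ?I x y) * f y)
      = (f x)\<^sup>2 * real (out_degree G x) - (\<Sum>y\<in>?V. ?I x y * (f x * f y))"
      using x fin by (simp add: sum_subtractf)
  qed
  also have "\<dots> = (\<Sum>(x, y)\<in>?E. (f x)\<^sup>2) - (\<Sum>(x, y)\<in>?E. f x * f y)"
    by (simp only: sum_subtractf sumE deg sum_distrib_left mult.commute)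
  finally have form: "(\<Sum>a<?n. \<Sum>b<?n. f (vs ! a) * laplacian_mat G vs $$ (a, b) * f (vs ! b))
     = (\<Sum>(x, y)\<in>?E. (f x)\<^sup>2) - (\<Sum>(x, y)\<in>?E. f x * f y)" .
  \<comment> \<open>Reversing the arcs lets the degree term be split evenly between tails and heads,
    which completes the square.\<close>
  have "(\<Sum>(x, y)\<in>?E. (f x)\<^sup>2) = (\<Sum>(x, y)\<in>?E. (f y)\<^sup>2)"
    by (rule sum.reindex_bij_witness[of _ prod.swap prod.swap])
      (use pair_sym_arcs in \<open>auto simp: symmetric_def sym_def\<close>)
  then have "2 * ((\<Sum>(x, y)\<in>?E. (f x)\<^sup>2) - (\<Sum>(x, y)\<in>?E. f x * f y))
     = (\<Sum>(x, y)\<in>?E. (f x)\<^sup>2) + (\<Sum>(x, y)\<in>?E. (f y)\<^sup>2) - 2 * (\<Sum>(x, y)\<in>?E. f x * f y)" by simp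
  also have "\<dots> = (\<Sum>(x, y)\<in>?E. (f x - f y)\<^sup>2)"
    by (simp add: case_prod_unfold power2_diff sum.distrib sum_subtractf sum_distrib_left mult.assoc)
  finally show ?thesis unfolding form .
qed

lemma laplacian_mat_symmetric:
  assumes G: "pair_graph G" and vs: "set vs = pverts G"
  shows "transpose_mat (laplacian_mat G vs) = laplacian_mat G vs"
proof -
  interpret pair_graph G by fact
  have "(x, y) \<in> parcs G \<longleftrightarrow> (y, x) \<in> parcs G" for x y
    using pair_sym_arcs by (auto simp: symmetric_def sym_def)
  then show ?thesis
    by (intro eq_matI) (auto simp: laplacian_mat_def degree_mat_def adjacency_mat_def)
qed

text \<open>The \<open>u i\<close> are the first \<open>k\<close> columns of an orthogonal matrix
  that diagonalizes the Laplacian in the order of \<open>laplacian_eigenvalues\<close>; each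
  eigenvalue is the quadratic form at its column.\<close>

lemma laplacian_sum_orthonormal:
  assumes G: "pair_graph G" and vs: "distinct vs" "set vs = pverts G" and k: "k \<le> length vs"
  obtains u where "orthonormal_on (pverts G) k u"
    "2 * laplacian_sum k G vs = (\<Sum>i<k. \<Sum>(x, y)\<in>parcs G. (u i x - u i y)\<^sup>2)"
proof -
  let ?L = "laplacian_mat G vs" and ?n = "length vs"
  define es where "es = laplacian_eigenvalues G vs"
  have L: "?L \<in> carrier_mat ?n ?n"
    by (simp add: laplacian_mat_def degree_mat_def adjacency_mat_def minus_carrier_mat)
  have sym: "transpose_mat ?L = ?L" by (rule laplacian_mat_symmetric[OF G vs(2)])
  obtain es0 where es0: "char_poly ?L = (\<Prod>e\<leftarrow>es0. [:- e, 1:])" "length es0 = ?n"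
    using real_symmetric_char_poly_splits[OF L sym] by blast
  \<comment> \<open>Since the polynomial splits, its roots with multiplicity are all of
    \<open>es0\<close>. The sorted list \<open>es\<close> is a rearrangement with \<open>?n\<close>
    entries, so \<open>take k\<close> is not cut short.\<close>
  have "proots (\<Prod>e\<leftarrow>es0. [:- e, 1:]) = mset es0" for es0 :: "real list"
  proof (induction es0)
    case (Cons a es0)
    have "(\<Prod>e\<leftarrow>es0. [:- e, 1:]) \<noteq> 0" by (auto simp: prod_list_zero_iff)
    then show ?case using Cons by (simp add: proots_mult del: mult_pCons_left)
  qed simp
  then have mset: "mset es = mset es0"
    by (simp add: es_def laplacian_eigenvalues_def es0)
  then have len: "length es = ?n" using es0(2) by (metis mset_eq_length)
  have "char_poly ?L = (\<Prod>e\<leftarrow>es. [:- e, 1:])"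
    unfolding es0(1) prod_mset_prod_list[symmetric] mset_map mset ..
  then obtain U where U: "U \<in> carrier_mat ?n ?n" and UU: "transpose_mat U * U = 1\<^sub>m ?n"
    and diag: "diag_mat (transpose_mat U * ?L * U) = es"
    using real_symmetric_orthogonal_diagonal[OF L sym] by blast
  \<comment> \<open>Column \<open>i\<close> read as a function on vertices: a vertex is sent back to
    its position in \<open>vs\<close>.\<close>
  define u where "u i v = U $$ (the_inv_into {..<?n} ((!) vs) v, i)" for i v
  have inj: "inj_on ((!) vs) {..<?n}" using vs(1) by (auto simp: inj_on_def nth_eq_iff_index_eq)
  have u: "u i (vs ! a) = U $$ (a, i)" if "a < ?n" for i a
    using that by (simp add: u_def the_inv_into_f_f[OF inj])
  have "orthonormal_on (pverts G) k u"
    unfolding orthonormal_on_def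
  proof (intro allI impI)
    fix i j assume ij: "i < k" "j < k"
    have "(\<Sum>v\<in>pverts G. u i v * u j v) = (\<Sum>a<?n. u i (vs ! a) * u j (vs ! a))"
      using sum.reindex_bij_betw[OF bij_betw_nth[OF vs(1) refl refl], of "\<lambda>v. u i v * u j v"] vs(2) by simp
    also have "\<dots> = (transpose_mat U * U) $$ (i, j)"
      using U ij k by (simp add: u scalar_prod_def atLeast0LessThan)
    finally show "(\<Sum>v\<in>pverts G. u i v * u j v) = (if i = j then 1 else 0)"
      unfolding UU using ij k by simp
  qed
  moreover have "2 * laplacian_sum k G vs = (\<Sum>i<k. \<Sum>(x, y)\<in>parcs G. (u i x - u i y)\<^sup>2)"
  proof -
    have es_nth: "2 * es ! i = (\<Sum>(x, y)\<in>parcs G. (u i x - u i y)\<^sup>2)" if "i < k" for i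
    proof -
      have i: "i < ?n" using that k by simp
      have "es ! i = (transpose_mat U * ?L * U) $$ (i, i)"
        unfolding diag[symmetric] diag_mat_def using U i by simp
      also have "\<dots> = (\<Sum>a<?n. U $$ (a, i) * (\<Sum>b<?n. ?L $$ (a, b) * U $$ (b, i)))"
        using U L i by (simp add: scalar_prod_def atLeast0LessThan)
      also have "\<dots> = (\<Sum>a<?n. \<Sum>b<?n. u i (vs ! a) * ?L $$ (a, b) * u i (vs ! b))"
        by (simp add: u sum_distrib_left mult.assoc)
      finally show ?thesis using laplacian_quadratic_form[OF G vs, of "u i"] by simp
    qed
    have "laplacian_sum k G vs = (\<Sum>i<k. es ! i)"
      using k len unfolding laplacian_sum_def es_def[symmetric]
      by (simp add: sum_list_sum_nth atLeast0LessThan)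
    then show ?thesis by (simp add: sum_distrib_left es_nth)
  qed
  ultimately show thesis by (rule that)
qed

section \<open>Arcs, undirected edges and connected components\<close>

lemma edge_set_pair: "edge_set (with_proj G) = (\<lambda>(x, y). {x, y}) ` parcs G"
  by (simp add: edge_set_def case_prod_unfold)

lemma card_edge: "pair_graph G \<Longrightarrow> e \<in> edge_set (with_proj G) \<Longrightarrow> card e = 2"
proof -
  assume "pair_graph G" and e: "e \<in> edge_set (with_proj G)"
  then interpret pair_graph G by simp
  show ?thesis using e pair_no_loops by (fastforce simp: edge_set_pair)
qed

lemma sum_arcs_edge_form:
  assumes "pair_graph G"
  shows "(\<Sum>(x, y)\<in>parcs G. (f x - f y)\<^sup>2) = 2 * (\<Sum>e\<in>edge_set (with_proj G). edge_form e f)"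
proof -
  interpret pair_graph G by fact
  let ?p = "\<lambda>(x, y). {x, y}"
  have sym: "(y, x) \<in> parcs G" if "(x, y) \<in> parcs G" for x y
    using that pair_sym_arcs by (auto simp: symmetric_def sym_def)
  have "(\<Sum>(x, y)\<in>parcs G. (f x - f y)\<^sup>2) = (\<Sum>e\<in>edge_set (with_proj G). \<Sum>(x, y)\<in>{a \<in> parcs G. ?p a = e}. (f x - f y)\<^sup>2)"
    unfolding edge_set_pair by (rule sum.image_gen[OF pair_finite_arcs])
  also have "\<dots> = (\<Sum>e\<in>edge_set (with_proj G). 2 * edge_form e f)"
  proof (intro sum.cong refl)
    fix e assume "e \<in> edge_set (with_proj G)"
    then obtain x y where xy: "(x, y) \<in> parcs G" "e = {x, y}" by (auto simp: edge_set_pair)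
    then have ne: "x \<noteq> y" using pair_no_loops by fastforce
    \<comment> \<open>Symmetry and the absence of loops make the fibre over an edge exactly two
      opposite arcs.\<close>
    have "{a \<in> parcs G. ?p a = e} = {(x, y), (y, x)}"
      using xy sym by (auto simp: doubleton_eq_iff)
    then show "(\<Sum>(x, y)\<in>{a \<in> parcs G. ?p a = e}. (f x - f y)\<^sup>2) = 2 * edge_form e f"
      using ne by (simp add: xy edge_form_pair power2_commute)
  qed
  finally show ?thesis by (simp add: sum_distrib_left)
qed

lemma pair_graph_delete_clique_edges:
  assumes "pair_graph G"
  shows "pair_graph (delete_clique_edges G K)"
proof -
  interpret pair_graph G by fact
  show ?thesis
    using in_arcsD1 in_arcsD2 pair_finite_verts pair_finite_arcs pair_sym_arcs pair_no_loops
    by unfold_locales (auto simp: delete_clique_edges_def symmetric_def sym_def)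
qed

text \<open>A second vertex of the component is reachable from \<open>v\<close>, so a walk leaves
  \<open>v\<close> along some arc.\<close>

lemma nontrivial_component_vertex_covered:
  assumes H: "pair_graph H" and C: "C \<in> nontrivial_components H" and v: "v \<in> verts C"
  shows "v \<in> \<Union>(edge_set (with_proj H))"
proof -
  interpret pair_graph H by fact
  have C': "C \<in> sccs" "2 \<le> card (verts C)" using C by (auto simp: nontrivial_components_def)
  obtain w where w: "w \<in> verts C" "w \<noteq> v"
    using C'(2) v by (metis One_nat_def card_le_Suc0_iff_eq card.infinite not_less_eq_eq numeral_2_eq_2 zero_le)
  have "verts C \<in> sccs_verts" using C'(1) by (auto simp: sccs_verts_conv)
  then have "v \<rightarrow>\<^sup>*\<^bsub>with_proj H\<^esub> w" using v w by (auto simp: in_sccs_verts_conv_reachable)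
  then obtain x where "(v, x) \<in> parcs H"
    using w(2) by (cases rule: converse_reachable_cases) auto
  then show ?thesis by (force simp: edge_set_pair)
qed

text \<open>An arc and its reverse make the endpoints mutually reachable, so the component of one
  endpoint contains both.\<close>

lemma edge_in_nontrivial_component:
  assumes H: "pair_graph H" and e: "e \<in> edge_set (with_proj H)"
  shows "\<exists>C \<in> nontrivial_components H. e \<in> edge_set C"
proof -
  interpret pair_graph H by fact
  obtain x y where xy: "(x, y) \<in> parcs H" "e = {x, y}" using e by (auto simp: edge_set_pair)
  then have ne: "x \<noteq> y" and x: "x \<in> pverts H" using pair_no_loops in_arcsD1 by fastforce+
  have yx: "(y, x) \<in> parcs H" using xy pair_sym_arcs by (auto simp: symmetric_def sym_def)
  let ?C = "with_proj H \<restriction> scc_of x"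
  have S: "scc_of x \<in> sccs_verts" using scc_of_in_sccs_verts x by simp
  have C: "?C \<in> sccs" using S by (rule in_verts_sccsD_sccs)
  have "x \<in> scc_of x" using in_scc_of_self x by simp
  moreover have "y \<in> scc_of x"
    using xy yx by (auto simp: scc_of_def intro!: reachable_adjI)
  ultimately have sub: "{x, y} \<subseteq> scc_of x" by simp
  have "scc_of x \<subseteq> pverts H" using sccs_verts_subsets[OF S] by simp
  then have "finite (scc_of x)" using pair_finite_verts finite_subset by blast
  then have "2 \<le> card (scc_of x)" using card_mono[OF _ sub] ne by simp
  then have "?C \<in> nontrivial_components H" using C by (simp add: nontrivial_components_def)
  moreover have "e \<in> edge_set ?C" using xy sub by (force simp: edge_set_def)
  ultimately show ?thesis by blast
qed

text \<open>Components partition the vertices and are non-empty, so each is trivial or has at least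
  two vertices; a trivial one counts 1.\<close>

lemma card_verts_nontrivial_components:
  assumes H: "pair_graph H"
  shows "finite (nontrivial_components H)"
    and "(\<Sum>C\<in>nontrivial_components H. card (verts C)) + card (trivial_components H) = card (pverts H)"
    and "card (\<Union>C\<in>nontrivial_components H. verts C) = (\<Sum>C\<in>nontrivial_components H. card (verts C))"
proof -
  interpret pair_graph H by fact
  let ?N = "nontrivial_components H" and ?T = "trivial_components H"
  have sub: "verts C \<subseteq> pverts H" if "C \<in> sccs" for C
    using that sccs_verts_subsets[of "verts C"] by (auto simp: sccs_verts_conv)
  then have finv: "finite (verts C)" if "C \<in> sccs" for C
    using that pair_finite_verts finite_subset by blast
  have fin: "finite sccs"
    using finite_imageD[OF _ inj_on_verts_sccs] finite_sccs_verts by (simp add: sccs_verts_conv)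
  have NT: "?N \<union> ?T = sccs"
  proof -
    have "card (verts C) \<ge> 1" if "C \<in> sccs" for C
    proof -
      have "verts C \<in> sccs_verts" using that by (auto simp: sccs_verts_conv)
      then have "verts C \<noteq> {}" by (simp add: in_sccs_verts_conv_reachable)
      then show ?thesis using finv[OF that] by (simp add: Suc_le_eq card_gt_0_iff)
    qed
    then show ?thesis by (force simp: nontrivial_components_def trivial_components_def)
  qed
  have disj: "?N \<inter> ?T = {}" by (auto simp: nontrivial_components_def trivial_components_def)
  show finN: "finite ?N" using fin NT by (metis finite_Un)
  have finT: "finite ?T" using fin NT by (metis finite_Un)
  have card_UN: "card (\<Union>C\<in>X. verts C) = (\<Sum>C\<in>X. card (verts C))" if "X \<subseteq> sccs" for X
  proof (rule card_UN_disjoint)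
    show "finite X" using finite_subset[OF that fin] .
    show "\<forall>C\<in>X. finite (verts C)" using that finv by blast
    show "\<forall>C\<in>X. \<forall>D\<in>X. C \<noteq> D \<longrightarrow> verts C \<inter> verts D = {}"
      using that scc_disj by (meson subsetD)
  qed
  show "card (\<Union>C\<in>?N. verts C) = (\<Sum>C\<in>?N. card (verts C))" using NT by (intro card_UN) auto
  have "(\<Union>C\<in>sccs. verts C) = pverts H"
  proof
    show "(\<Union>C\<in>sccs. verts C) \<subseteq> pverts H" using sub by blast
    show "pverts H \<subseteq> (\<Union>C\<in>sccs. verts C)"
    proof
      fix x assume "x \<in> pverts H"
      then have "x \<in> scc_of x" "scc_of x \<in> verts ` sccs"
        using in_scc_of_self scc_of_in_sccs_verts by (auto simp: sccs_verts_conv)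
      then show "x \<in> (\<Union>C\<in>sccs. verts C)" by auto
    qed
  qed
  then have "card (pverts H) = (\<Sum>C\<in>?N \<union> ?T. card (verts C))"
    using card_UN[of sccs] NT by simp
  also have "\<dots> = (\<Sum>C\<in>?N. card (verts C)) + (\<Sum>C\<in>?T. card (verts C))"
    by (rule sum.union_disjoint[OF finN finT disj])
  also have "(\<Sum>C\<in>?T. card (verts C)) = card ?T"
    by (simp add: trivial_components_def)
  finally show "(\<Sum>C\<in>?N. card (verts C)) + card ?T = card (pverts H)" by simp
qed

text \<open>The non-trivial components have \<open>n - p\<close> vertices in total. The edges number
  at most \<open>(n - p) + r(c - 1)\<close> and cover at least these \<open>n - p\<close> vertices;
  doubling the first bound and subtracting the second gives the claim.\<close>

lemma c_cyclic_components_edge_count: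
  assumes H: "pair_graph H" and cyc: "\<forall>C \<in> nontrivial_components H. c_cyclic c C"
  shows "2 * real (card (edge_set (with_proj H))) - real (card (\<Union>(edge_set (with_proj H))))
    \<le> real (card (pverts H)) - real (card (trivial_components H))
      + 2 * real (card (nontrivial_components H)) * (real c - 1)"
proof -
  interpret pair_graph H by fact
  let ?N = "nontrivial_components H" and ?E = "edge_set (with_proj H)"
  note comps = card_verts_nontrivial_components[OF H]
  \<comment> \<open>The count is taken over the integers and reals, so for trees,
    \<open>c = 0\<close>, the summand \<open>c - 1\<close> is -1 and not truncated.\<close>
  have eC: "real (card (edge_set C)) = real (card (verts C)) + (real c - 1)" if "C \<in> ?N" for C
    using cyc that by (fastforce simp: c_cyclic_def)
  have finE: "finite ?E" using pair_finite_arcs by (simp add: edge_set_pair)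
  have "?E \<subseteq> (\<Union>C\<in>?N. edge_set C)" using edge_in_nontrivial_component[OF H] by blast
  moreover have "finite (edge_set C)" if "C \<in> ?N" for C
  proof -
    interpret C: graph C using cyc that by (simp add: c_cyclic_def)
    show ?thesis by (simp add: edge_set_def C.finite_arcs)
  qed
  ultimately have "card ?E \<le> card (\<Union>C\<in>?N. edge_set C)"
    using comps(1) by (intro card_mono) auto
  also have "\<dots> \<le> (\<Sum>C\<in>?N. card (edge_set C))" by (rule card_UN_le[OF comps(1)])
  finally have "real (card ?E) \<le> (\<Sum>C\<in>?N. real (card (edge_set C)))"
    by (metis of_nat_le_iff of_nat_sum)
  also have "\<dots> = (\<Sum>C\<in>?N. real (card (verts C))) + real (card ?N) * (real c - 1)"
    by (simp add: eC sum.distrib)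
  finally have 1: "real (card ?E) \<le> (\<Sum>C\<in>?N. real (card (verts C))) + real (card ?N) * (real c - 1)" .
  have "finite (\<Union>?E)" using finE card_edge[OF H] by (rule finite_Union_edges)
  moreover have "(\<Union>C\<in>?N. verts C) \<subseteq> \<Union>?E" using nontrivial_component_vertex_covered[OF H] by blast
  ultimately have "(\<Sum>C\<in>?N. card (verts C)) \<le> card (\<Union>?E)" using card_mono comps(3) by metis
  then have 2: "(\<Sum>C\<in>?N. real (card (verts C))) \<le> real (card (\<Union>?E))"
    by (metis of_nat_le_iff of_nat_sum)
  have 3: "(\<Sum>C\<in>?N. real (card (verts C))) + real (card (trivial_components H)) = real (card (pverts H))"
    using comps(2) by (metis of_nat_add of_nat_sum)
  show ?thesis using 1 2 3 by linarith
qed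

section \<open>The arcs inside the clique\<close>

lemma clique_arcs_form_le:
  assumes K: "finite K" and A: "A \<subseteq> K \<times> K"
  shows "(\<Sum>(x, y)\<in>A. (f x - f y)\<^sup>2) \<le> 2 * real (card K) * (\<Sum>v\<in>K. (f v)\<^sup>2)"
proof -
  have "(\<Sum>(x, y)\<in>A. (f x - f y)\<^sup>2) \<le> (\<Sum>(x, y)\<in>K \<times> K. (f x - f y)\<^sup>2)"
    using K A by (intro sum_mono2) auto
  also have "\<dots> = (\<Sum>x\<in>K. \<Sum>y\<in>K. (f x)\<^sup>2 + (f y)\<^sup>2 - 2 * (f x * f y))"
    by (simp add: sum.cartesian_product power2_diff mult.assoc)
  \<comment> \<open>Twice the form of \<open>|K| I - J\<close>, the Laplacian of the complete graph,
    with \<open>J\<close> the all-ones matrix; the form of \<open>J\<close> is a square and is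
    dropped.\<close>
  also have "\<dots> = 2 * real (card K) * (\<Sum>v\<in>K. (f v)\<^sup>2) - 2 * (\<Sum>v\<in>K. f v)\<^sup>2"
    by (simp add: sum.distrib sum_subtractf sum_distrib_left[symmetric] sum_distrib_right[symmetric]
        power2_eq_square)
  finally show ?thesis by (smt (verit) zero_le_power2)
qed

text \<open>Exchanging the sums, each arc contributes at most 2 over the whole family, and there are
  at most \<open>|K| (|K| - 1)\<close> arcs.\<close>

lemma clique_arcs_trace_le:
  assumes K: "finite K" and A: "A \<subseteq> {(x, y) \<in> K \<times> K. x \<noteq> y}"
    and V: "finite V" "K \<subseteq> V" and on: "orthonormal_on V k u"
  shows "(\<Sum>i<k. \<Sum>(x, y)\<in>A. (u i x - u i y)\<^sup>2) \<le> 2 * (real (card K) * (real (card K) - 1))"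
proof -
  let ?D = "{(x, y) \<in> K \<times> K. x \<noteq> y}"
  have fin: "finite ?D" by (rule finite_subset[of _ "K \<times> K"]) (use K in auto)
  have "?D \<union> (\<lambda>x. (x, x)) ` K = K \<times> K" by auto
  moreover have "card (?D \<union> (\<lambda>x. (x, x)) ` K) = card ?D + card ((\<lambda>x. (x, x)) ` K)"
    using K fin by (intro card_Un_disjoint) auto
  ultimately have "card ?D + card ((\<lambda>x. (x, x)) ` K) = card (K \<times> K)" by simp
  then have cD: "real (card ?D) + real (card K) = real (card K) * real (card K)"
    by (simp add: card_cartesian_product card_image inj_on_def flip: of_nat_add of_nat_mult)
  have "(\<Sum>i<k. \<Sum>(x, y)\<in>A. (u i x - u i y)\<^sup>2) = (\<Sum>a\<in>A. \<Sum>i<k. case a of (x, y) \<Rightarrow> (u i x - u i y)\<^sup>2)"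
    by (rule sum.swap)
  also have "\<dots> \<le> (\<Sum>a\<in>A. 2)"
  proof (intro sum_mono)
    fix a assume "a \<in> A"
    then obtain x y where "a = (x, y)" "x \<in> V" "y \<in> V" using A V by blast
    then show "(\<Sum>i<k. case a of (x, y) \<Rightarrow> (u i x - u i y)\<^sup>2) \<le> 2"
      using edge_form_trace[OF V(1) _ _ on] by simp
  qed
  also have "\<dots> \<le> 2 * real (card ?D)" using card_mono[OF fin A] by simp
  finally show ?thesis using cD unfolding right_diff_distrib by linarith
qed

section \<open>Splitting the Laplacian sum between the clique and \<open>H\<close>\<close>

theorem theorem2p2:
  fixes G H :: "'a pair_pre_digraph"
    and vs :: "'a list" and K :: "'a set"
    and n m \<omega> c r p k :: nat
  assumes "pair_graph G" and "connected G"
    and "distinct vs" and "set vs = pverts G"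
    and "card (pverts G) = n" and "n \<ge> 4"
    and "card (edge_set G) = m"
    and "clique_number G = \<omega>" and "\<omega> \<ge> 2"
    and "is_clique G K" and "card K = \<omega>"
    and "H = delete_clique_edges G K"
    and "card (nontrivial_components H) = r"
    and "\<forall>C \<in> nontrivial_components H. c_cyclic c C"
    and "card (trivial_components H) = p"
    and "1 \<le> k" and "k \<le> n"
  shows "(k \<ge> \<omega> - 1 \<longrightarrow> laplacian_sum k G vs
            \<le> real \<omega> * (real \<omega> - 1) + real n - real p + 2 * real r * (real c - 1) + 2 * real k)
       \<and> (k \<le> \<omega> - 2 \<longrightarrow> laplacian_sum k G vs
            \<le> real k * (real \<omega> + 2) + real n - real p + 2 * real r * (real c - 1))"
proof -
  note G = assms(1) and vs = assms(3,4) and n = assms(5) and Hdef = assms(12) and kn = assms(17)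
  interpret pair_graph G by (rule G)
  let ?V = "pverts G" and ?E = "edge_set (with_proj H)"
  have H: "pair_graph H" unfolding Hdef by (rule pair_graph_delete_clique_edges[OF G])
  interpret H: pair_graph H by (rule H)
  have VH: "pverts H = ?V" by (simp add: Hdef delete_clique_edges_def)
  have V: "finite ?V" by (rule pair_finite_verts)
  have KV: "K \<subseteq> ?V" using assms(10) by (simp add: is_clique_def)
  then have K: "finite K" using V finite_subset by blast
  have len: "k \<le> length vs" using distinct_card[OF vs(1)] vs(2) n kn by simp
  obtain u where on: "orthonormal_on ?V k u"
    and S: "2 * laplacian_sum k G vs = (\<Sum>i<k. \<Sum>(x, y)\<in>parcs G. (u i x - u i y)\<^sup>2)"
    using laplacian_sum_orthonormal[OF G vs len] by blast
  define A where "A = parcs G \<inter> K \<times> K"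
  have arcs: "parcs G = A \<union> parcs H" "A \<inter> parcs H = {}"
    by (auto simp: A_def Hdef delete_clique_edges_def)
  have finA: "finite A" by (simp add: A_def pair_finite_arcs)
  \<comment> \<open>The clique is left as arcs and \<open>H\<close> is turned into undirected edges;
    hence the factor 2 on the second sum only.\<close>
  have split: "2 * laplacian_sum k G vs
      = (\<Sum>i<k. \<Sum>(x, y)\<in>A. (u i x - u i y)\<^sup>2) + 2 * (\<Sum>i<k. \<Sum>e\<in>?E. edge_form e (u i))"
    unfolding S arcs(1) sum.union_disjoint[OF finA H.pair_finite_arcs arcs(2)]
    by (simp only: sum.distrib sum_arcs_edge_form[OF H] sum_distrib_left)
  have "(\<Sum>i<k. \<Sum>e\<in>?E. edge_form e (u i)) \<le> 2 * real k + 2 * real (card ?E) - real (card (\<Union>?E))"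
  proof (rule sum_edge_form_le[OF _ _ V _ on])
    show "finite ?E" using H.pair_finite_arcs by (simp add: edge_set_pair)
    show "card e = 2" if "e \<in> ?E" for e using card_edge[OF H that] .
    show "\<Union>?E \<subseteq> ?V" using H.in_arcsD1 H.in_arcsD2 VH by (auto simp: edge_set_pair)
  qed
  also have "\<dots> \<le> 2 * real k + (real n - real p + 2 * real r * (real c - 1))"
    using c_cyclic_components_edge_count[OF H assms(14)] VH n assms(13,15) by simp
  finally have rest: "(\<Sum>i<k. \<Sum>e\<in>?E. edge_form e (u i))
      \<le> 2 * real k + (real n - real p + 2 * real r * (real c - 1))" .
  have "A \<subseteq> {(x, y) \<in> K \<times> K. x \<noteq> y}" using pair_no_loops by (fastforce simp: A_def)
  from clique_arcs_trace_le[OF K this V KV on]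
  \<comment> \<open>After halving, the clique contributes at most
    \<open>\<omega> (\<omega> - 1)\<close> by the trace and, further below, at most
    \<open>k \<omega>\<close> by the unit norms; the two agree at \<open>k = \<omega> - 1\<close>,
    where the cases divide.\<close>
  have trace: "(\<Sum>i<k. \<Sum>(x, y)\<in>A. (u i x - u i y)\<^sup>2) \<le> 2 * (real \<omega> * (real \<omega> - 1))"
    unfolding assms(11) .
  have "(\<Sum>(x, y)\<in>A. (u i x - u i y)\<^sup>2) \<le> 2 * real \<omega>" if "i < k" for i
  proof -
    have "(\<Sum>v\<in>K. (u i v)\<^sup>2) \<le> (\<Sum>v\<in>?V. (u i v)\<^sup>2)" using V KV by (intro sum_mono2) auto
    also have "\<dots> = 1" by (rule orthonormal_on_norm[OF on that])
    finally have "2 * real \<omega> * (\<Sum>v\<in>K. (u i v)\<^sup>2) \<le> 2 * real \<omega> * 1"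
      by (intro mult_left_mono) auto
    moreover have "A \<subseteq> K \<times> K" by (auto simp: A_def)
    ultimately show ?thesis using clique_arcs_form_le[OF K, of A "u i"] assms(11) by simp
  qed
  then have "(\<Sum>i<k. \<Sum>(x, y)\<in>A. (u i x - u i y)\<^sup>2) \<le> (\<Sum>i<k. 2 * real \<omega>)"
    by (intro sum_mono) auto
  then have norm: "(\<Sum>i<k. \<Sum>(x, y)\<in>A. (u i x - u i y)\<^sup>2) \<le> 2 * (real k * real \<omega>)" by simp
  have "laplacian_sum k G vs \<le> real \<omega> * (real \<omega> - 1) + real n - real p
      + 2 * real r * (real c - 1) + 2 * real k"
    using split rest trace by linarith
  \<comment> \<open>The \<open>2k\<close> coming from \<open>H\<close> is absorbed into
    \<open>k (\<omega> + 2)\<close>.\<close>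
  moreover have "laplacian_sum k G vs \<le> real k * (real \<omega> + 2) + real n - real p
      + 2 * real r * (real c - 1)"
    unfolding distrib_left using split rest norm by linarith
  ultimately show ?thesis by blast
qed

end
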